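(* Let $\bar\gamma_b,\bar\gamma_e>0$ and $q_b,q_e\in(0,1]$, and let $\gamma_b$ and $\gamma_e$ be independent random variables following squared Hoyt distributions with averages $\bar\gamma_b$, $\bar\gamma_e$ and parameters $q_b$, $q_e$, respectively. Let $$C_S=\left[\log_2(1+\gamma_b)-\log_2(1+\gamma_e)\right]^+,\qquad [a]^+=\max\{a,0\},$$ and put $\epsilon_b=\frac{1-q_b^2}{1+q_b^2}$, $\epsilon_e=\frac{1-q_e^2}{1+q_e^2}$, $\bar\gamma_b(\theta)=\bar\gamma_b(1-\epsilon_b\cos\theta)$. Then for every $R_S>0$, $$P(C_S<R_S)=1-\frac{1}{\pi}\int_0^\pi\exp\left(-\frac{2^{R_S}-1}{\bar\gamma_b(\theta)}\right)\frac{\bar\gamma_b(\theta)}{\bar\gamma_b(\theta)+2^{R_S}\bar\gamma_e}\,\frac{1}{\sqrt{1-\left(\frac{\epsilon_e2^{R_S}\bar\gamma_e}{\bar\gamma_b(\theta)+2^{R_S}\bar\gamma_e}\right)^2}}\,d\theta,$$ and $$P(C_S>0)=\frac{1}{\pi}\int_0^\pi\frac{\bar\gamma_b(\theta)}{\bar\gamma_b(\theta)+\bar\gamma_e}\,\frac{1}{\sqrt{1-\left(\frac{\epsilon_e\bar\gamma_e}{\bar\gamma_b(\theta)+\bar\gamma_e}\right)^2}}\,d\theta.$$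
   Context: The squared Hoyt distribution with average $\overline{\gamma}>0$ and parameter $q\in(0,1]$ has pdf on $[0,\infty)$ $$f(x)=\frac{1+q^2}{2q\overline{\gamma}}\exp\left[-\frac{(1+q^2)^2x}{4q^2\overline{\gamma}}\right]I_0\left(\frac{(1-q^4)x}{4q^2\overline{\gamma}}\right),$$ where $I_0$ is the modified Bessel function of the first kind and order zero. In the application, $\gamma_b$ and $\gamma_e$ are the instantaneous signal-to-noise ratios at the legitimate receiver and at the eavesdropper, $C_S$ is the secrecy capacity (normalized bandwidth), and $R_S$ is the threshold rate. *)

theory Defs
  imports "HOL-Probability.Probability"
begin

definition bessel_I0 :: "real \<Rightarrow> real" where
  "bessel_I0 x = (\<Sum>k. (x / 2) ^ (2 * k) / (fact k)\<^sup>2)"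

(* The density is extended by 0 from [0, \<infinity>) to the whole line;
   g is the average, usually written \<gamma> with a bar. *)
definition squared_hoyt_density :: "real \<Rightarrow> real \<Rightarrow> real \<Rightarrow> real" where
  "squared_hoyt_density g q x =
     (if x < 0 then 0
      else (1 + q\<^sup>2) / (2 * q * g)
           * exp (- ((1 + q\<^sup>2)\<^sup>2 * x / (4 * q\<^sup>2 * g)))
           * bessel_I0 ((1 - q ^ 4) * x / (4 * q\<^sup>2 * g)))"

definition squared_hoyt_distributed :: "'a measure \<Rightarrow> ('a \<Rightarrow> real) \<Rightarrow> real \<Rightarrow> real \<Rightarrow> bool" where
  "squared_hoyt_distributed M X g q \<longleftrightarrow>
     distributed M lborel X (\<lambda>x. ennreal (squared_hoyt_density g q x))"

definition secrecy_capacity :: "real \<Rightarrow> real \<Rightarrow> real" where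
  "secrecy_capacity \<gamma>b \<gamma>e = max (log 2 (1 + \<gamma>b) - log 2 (1 + \<gamma>e)) 0"

definition hoyt_eps :: "real \<Rightarrow> real" where
  "hoyt_eps q = (1 - q\<^sup>2) / (1 + q\<^sup>2)"

definition hoyt_mean :: "real \<Rightarrow> real \<Rightarrow> real \<Rightarrow> real" where
  "hoyt_mean g q \<theta> = g * (1 - hoyt_eps q * cos \<theta>)"

end

theory Submission
  imports Defs
begin

text \<open>
  A squared Hoyt variable is a mixture of exponential variables with means
  \<open>h \<theta> = g (1 - \<epsilon> cos \<theta>)\<close>, where \<open>\<theta>\<close> is uniform on \<open>[0, \<pi>]\<close>. To see this, write
  \<open>I\<^sub>0 z = (1/\<pi>) \<integral> exp (z cos E) dE\<close> and pass from the eccentric anomaly \<open>E\<close> to the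
  true anomaly \<open>\<theta>\<close> of Kepler's equation, \<open>cos E = (cos \<theta> - \<epsilon>) / (1 - \<epsilon> cos \<theta>)\<close>.
  Both events compare \<open>\<gamma>\<^sub>b\<close> with an affine function \<open>t \<gamma>\<^sub>e + c\<close>. Conditionally on \<open>\<theta>\<close>
  and \<open>\<gamma>\<^sub>e\<close>, the tail of \<open>\<gamma>\<^sub>b\<close> is \<open>exp (- (t \<gamma>\<^sub>e + c) / h \<theta>)\<close>, so averaging over \<open>\<gamma>\<^sub>e\<close>
  leaves its Laplace transform at \<open>t / h \<theta>\<close>, which is again a mixture and is evaluated
  by the same substitution.
\<close>

section \<open>Cosine power integrals and the integral representation of
  \<open>I\<^sub>0\<close>\<close>

text \<open>The Wallis recurrence: \<open>cos x ^ (n + 1) * sin x\<close> vanishes at 0 and pi, so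
  its derivative has integral 0. Replacing the squared sine by \<open>1 - cos x * cos x\<close>
  leaves only the powers \<open>n\<close> and \<open>n + 2\<close>.\<close>

lemma cos_power_integral_Suc_Suc:
  assumes "((\<lambda>x::real. cos x ^ n) has_integral w) {0..pi}"
  shows "((\<lambda>x. cos x ^ (n + 2)) has_integral (real n + 1) / (real n + 2) * w) {0..pi}"
proof -
  have "((\<lambda>x. (real n + 2) * cos x ^ (n + 2) - (real n + 1) * cos x ^ n) has_integral
          (cos pi ^ (n + 1) * sin pi - cos 0 ^ (n + 1) * sin 0)) {0..pi}"
  proof (rule fundamental_theorem_of_calculus)
    fix x :: real
    have s: "sin x * sin x = 1 - cos x * cos x"
      using sin_squared_eq[of x] by (simp add: power2_eq_square)
    have "((\<lambda>x. cos x ^ (n + 1) * sin x) has_real_derivative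
            (real n + 2) * cos x ^ (n + 2) - (real n + 1) * cos x ^ n) (at x within {0..pi})"
    proof (rule DERIV_cong)
      show "((\<lambda>x. cos x ^ (n + 1) * sin x) has_real_derivative
          cos x ^ (n + 1) * cos x + ((1 + real n) * (- sin x * cos x ^ n)) * sin x) (at x within {0..pi})"
        unfolding Suc_eq_plus1[symmetric]
        by (intro DERIV_mult' DERIV_power_Suc DERIV_sin DERIV_cos has_field_derivative_at_within[OF DERIV_sin]
            has_field_derivative_at_within[OF DERIV_cos])
      have "cos x ^ (n + 1) * cos x + ((1 + real n) * (- sin x * cos x ^ n)) * sin x
          = cos x ^ n * (cos x * cos x) - (real n + 1) * cos x ^ n * (sin x * sin x)"
        by (simp add: algebra_simps)
      also have "\<dots> = (real n + 2) * cos x ^ (n + 2) - (real n + 1) * cos x ^ n"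
        unfolding s by (simp add: algebra_simps)
      finally show "cos x ^ (n + 1) * cos x + ((1 + real n) * (- sin x * cos x ^ n)) * sin x
          = (real n + 2) * cos x ^ (n + 2) - (real n + 1) * cos x ^ n" .
    qed
    then show "((\<lambda>x. cos x ^ (n + 1) * sin x) has_vector_derivative
            (real n + 2) * cos x ^ (n + 2) - (real n + 1) * cos x ^ n) (at x within {0..pi})"
      by (simp add: has_real_derivative_iff_has_vector_derivative)
  qed simp
  from has_integral_mult_right[OF has_integral_add[OF this has_integral_mult_right[OF assms, of "real n + 1"]],
      of "1 / (real n + 2)"]
  show ?thesis by simp
qed

text \<open>In this form \<open>fact (2 * k)\<close> cancels the denominator of the exponential
  series, and \<open>4 ^ k * (fact k)\<^sup>2\<close> yields the Bessel coefficient.\<close>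

lemma cos_power_even_integral:
  "((\<lambda>x::real. cos x ^ (2 * k)) has_integral pi * fact (2 * k) / (4 ^ k * (fact k)\<^sup>2)) {0..pi}"
proof (induction k)
  case 0
  show ?case using has_integral_const_real[of "1::real" 0 pi] by simp
next
  case (Suc k)
  have "(real (2 * k) + 1) / (real (2 * k) + 2) * (pi * fact (2 * k) / (4 ^ k * (fact k)\<^sup>2))
        = pi * fact (2 * Suc k) / (4 ^ Suc k * (fact (Suc k))\<^sup>2)"
    by (simp add: divide_simps) (simp add: power2_eq_square algebra_simps)
  then show ?case using cos_power_integral_Suc_Suc[OF Suc.IH] by simp
qed

lemma cos_power_odd_integral:
  "((\<lambda>x::real. cos x ^ (2 * k + 1)) has_integral 0) {0..pi}"
proof (induction k)
  case 0
  have "(cos has_integral (sin pi - sin 0)) {0..pi}"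
    by (rule fundamental_theorem_of_calculus)
       (auto intro!: derivative_eq_intros simp flip: has_real_derivative_iff_has_vector_derivative)
  then show ?case by simp
next
  case (Suc k)
  then show ?case using cos_power_integral_Suc_Suc[OF Suc.IH] by simp
qed

text \<open>Expand the exponential and integrate termwise: the odd terms vanish by symmetry of the
  cosine about pi/2, and the even ones form the series defining \<open>bessel_I0\<close>.\<close>

lemma bessel_I0_integral:
  "((\<lambda>x. exp (z * cos x)) has_integral pi * bessel_I0 z) {0..pi}"
proof -
  define a where "a n x = (z * cos x) ^ n / fact n" for n and x :: real
  define w where "w n = integral {0..pi} (a n)" for n
  \<comment> \<open>Since the cosine is bounded by 1, the exponential series of
    \<open>\<bar>z\<bar>\<close> majorises uniformly in \<open>x\<close>; this justifies exchanging
    sum and integral.\<close>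
  have u: "uniform_limit {0..pi} (\<lambda>n x. \<Sum>i<n. a i x) (\<lambda>x. \<Sum>i. a i x) sequentially"
  proof (rule Weierstrass_m_test)
    show "norm (a n x) \<le> \<bar>z\<bar> ^ n / fact n" for n x
      by (auto simp: a_def power_mult_distrib abs_mult power_abs intro!: divide_right_mono
          mult_left_le power_le_one)
    show "summable (\<lambda>n. \<bar>z\<bar> ^ n / fact n)"
      using summable_exp[of "\<bar>z\<bar>"] by (simp add: field_simps)
  qed
  have lim: "(\<Sum>i. a i x) = exp (z * cos x)" for x
    by (simp add: a_def exp_def divide_inverse mult.commute scaleR_conv_of_real)
  have int: "(a n has_integral w n) {0..pi}" for n
    unfolding w_def a_def by (intro integrable_integral integrable_continuous_real continuous_intros) auto
  have contn: "continuous_on {0..pi} (\<lambda>x. \<Sum>i<n. a i x)" for n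
    unfolding a_def by (intro continuous_intros) auto
  obtain I J where I: "\<And>n. ((\<lambda>x. \<Sum>i<n. a i x) has_integral I n) {0..pi}"
    and J: "((\<lambda>x. \<Sum>i. a i x) has_integral J) {0..pi}" and IJ: "I \<longlonglongrightarrow> J"
    using uniform_limit_integral[OF u contn] by auto
  have "I n = (\<Sum>i<n. w i)" for n
    using has_integral_unique[OF I has_integral_sum[of "{..<n}" a w, OF _ int]] by auto
  then have "I = (\<lambda>n. \<Sum>i<n. w i)" by (rule ext)
  with IJ have "w sums J" by (simp add: sums_def)
  moreover have odd: "w n = 0" if "n \<notin> range (\<lambda>k. 2 * k)" for n
  proof -
    obtain k where "n = 2 * k + 1" using \<open>n \<notin> _\<close> by (metis oddE rangeI dvd_def)
    then have "(a n has_integral 0) {0..pi}"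
      using has_integral_mult_right[OF cos_power_odd_integral[of k], of "z ^ n / fact n"]
      by (simp add: a_def[abs_def] power_mult_distrib)
    then show ?thesis using int has_integral_unique by blast
  qed
  \<comment> \<open>Dropping the vanishing odd terms keeps the sum.\<close>
  ultimately have "(\<lambda>k. w (2 * k)) sums J"
    by (subst sums_mono_reindex) (auto simp: strict_mono_def)
  moreover have "w (2 * k) = pi * ((z / 2) ^ (2 * k) / (fact k)\<^sup>2)" for k
  proof -
    have "(a (2 * k) has_integral z ^ (2 * k) / fact (2 * k) * (pi * fact (2 * k) / (4 ^ k * (fact k)\<^sup>2))) {0..pi}"
      using has_integral_mult_right[OF cos_power_even_integral[of k], of "z ^ (2 * k) / fact (2 * k)"]
      by (simp add: a_def[abs_def] power_mult_distrib)
    from has_integral_unique[OF int this] show ?thesis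
      by (simp add: power_divide power_mult)
  qed
  ultimately have "(\<lambda>k. pi * ((z / 2) ^ (2 * k) / (fact k)\<^sup>2)) sums J" by simp
  then have "(\<lambda>k. (z / 2) ^ (2 * k) / (fact k)\<^sup>2) sums (J / pi)"
    using sums_mult[of _ J "1 / pi"] by fastforce
  then have "J = pi * bessel_I0 z" by (simp add: bessel_I0_def sums_iff)
  with J lim show ?thesis by simp
qed

section \<open>The substitution from eccentric to true anomaly\<close>

lemma one_minus_mult_cos_pos:
  fixes e :: real
  assumes "\<bar>e\<bar> < 1"
  shows "0 < 1 - e * cos x"
proof -
  have "\<bar>e * cos x\<bar> \<le> \<bar>e\<bar> * 1"
    unfolding abs_mult by (intro mult_left_mono) auto
  with assms show ?thesis by linarith
qed

text \<open>Change of variables \<open>E = arccos (u \<theta>)\<close>, which maps 0 to 0 and pi to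
  pi. The factor in front of \<open>F\<close> is the derivative of \<open>E\<close> with respect to
  \<open>\<theta>\<close>.\<close>

lemma kepler_substitution:
  fixes e :: real and F :: "real \<Rightarrow> real"
  assumes e: "\<bar>e\<bar> < 1" and F: "continuous_on {-1..1} F"
  shows "((\<lambda>\<theta>. sqrt (1 - e\<^sup>2) / (1 - e * cos \<theta>) * F ((cos \<theta> - e) / (1 - e * cos \<theta>)))
           has_integral integral {0..pi} (\<lambda>E. F (cos E))) {0..pi}"
proof -
  define u where "u \<theta> = (cos \<theta> - e) / (1 - e * cos \<theta>)" for \<theta>
  have pos: "0 < 1 - e * cos x" for x
    using e by (rule one_minus_mult_cos_pos)
  have e2: "0 < 1 - e\<^sup>2" using e by (simp add: abs_square_less_1)
  have u1: "-1 \<le> u \<theta>" "u \<theta> \<le> 1" for \<theta>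
  proof -
    have "0 \<le> 1 - e" "0 \<le> 1 + e" using e by auto
    moreover have "0 \<le> 1 + cos \<theta>" "0 \<le> 1 - cos \<theta>"
      using cos_ge_minus_one[of \<theta>] cos_le_one[of \<theta>] by linarith+
    \<comment> \<open>These products are the numerators of \<open>1 + u \<theta>\<close> and
      \<open>1 - u \<theta>\<close>.\<close>
    ultimately have "0 \<le> (1 - e) * (1 + cos \<theta>)" "0 \<le> (1 + e) * (1 - cos \<theta>)"
      by (auto intro: mult_nonneg_nonneg)
    then show "-1 \<le> u \<theta>" "u \<theta> \<le> 1"
      using pos[of \<theta>] by (auto simp: u_def field_simps)
  qed
  have u_ends: "u 0 = 1" "u pi = -1" using e by (auto simp: u_def divide_simps)
  have "((\<lambda>\<theta>. (sqrt (1 - e\<^sup>2) / (1 - e * cos \<theta>)) *\<^sub>R F (cos (arccos (u \<theta>)))) has_integral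
          integral {arccos (u 0)..arccos (u pi)} (\<lambda>E. F (cos E))) {0..pi}"
  \<comment> \<open>At 0 and pi, \<open>u\<close> takes the values 1 and -1, where arccos is not
    differentiable; the rule tolerates this finite exceptional set.\<close>
  proof (rule has_integral_substitution_strong[where s = "{0, pi}" and c = 0 and d = pi])
    show "(\<lambda>\<theta>. arccos (u \<theta>)) ` {0..pi} \<subseteq> {0..pi}"
      by (auto simp: u1 arccos_lbound arccos_ubound)
    show "continuous_on {0..pi} (\<lambda>E. F (cos E))"
      by (intro continuous_on_compose2[OF F] continuous_intros) auto
    have "continuous_on {0..pi} u"
      unfolding u_def using pos by (intro continuous_intros) (auto simp: less_le)
    then show "continuous_on {0..pi} (\<lambda>\<theta>. arccos (u \<theta>))"
      using u1 by (intro continuous_on_compose2[OF continuous_on_arccos']) auto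
    fix \<theta> assume "\<theta> \<in> {0..pi} - {0, pi}"
    then have s: "0 < sin \<theta>" by (auto intro: sin_gt_zero)
    have p: "0 < 1 - e * cos \<theta>" by (rule pos)
    \<comment> \<open>This is the square of \<open>sin E\<close>. In the interior
      \<open>sin \<theta>\<close> is positive, which fixes the sign of the root; it then cancels
      against the derivative of \<open>u\<close>.\<close>
    have sq: "1 - (u \<theta>)\<^sup>2 = (sqrt (1 - e\<^sup>2) * sin \<theta> / (1 - e * cos \<theta>))\<^sup>2"
      using p e2 by (simp add: u_def power_divide power_mult_distrib sin_squared_eq divide_simps)
        (simp add: power2_eq_square algebra_simps)
    have root: "sqrt (1 - (u \<theta>)\<^sup>2) = sqrt (1 - e\<^sup>2) * sin \<theta> / (1 - e * cos \<theta>)"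
      unfolding sq using s p e2 by (intro real_sqrt_unique) auto
    have "0 < 1 - (u \<theta>)\<^sup>2" unfolding sq using s p e2 by simp
    then have "\<bar>u \<theta>\<bar> < 1" by (simp add: abs_square_less_1)
    then have u: "-1 < u \<theta>" "u \<theta> < 1" by auto
    have du: "(u has_real_derivative - (1 - e\<^sup>2) * sin \<theta> / (1 - e * cos \<theta>)\<^sup>2) (at \<theta>)"
      unfolding u_def using p
      by (auto intro!: derivative_eq_intros simp: divide_simps power2_eq_square)
        (auto simp: algebra_simps)
    have "((\<lambda>\<theta>. arccos (u \<theta>)) has_real_derivative
         inverse (- sqrt (1 - (u \<theta>)\<^sup>2)) * (- (1 - e\<^sup>2) * sin \<theta> / (1 - e * cos \<theta>)\<^sup>2)) (at \<theta>)"
      by (rule DERIV_chain2[OF DERIV_arccos du]) (use u in auto)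
    moreover have "1 - e\<^sup>2 = sqrt (1 - e\<^sup>2) * sqrt (1 - e\<^sup>2)" using e2 by simp
    then have "inverse (- sqrt (1 - (u \<theta>)\<^sup>2)) * (- (1 - e\<^sup>2) * sin \<theta> / (1 - e * cos \<theta>)\<^sup>2)
        = sqrt (1 - e\<^sup>2) / (1 - e * cos \<theta>)"
      unfolding root using s p e2 by (simp add: divide_simps power2_eq_square)
    ultimately have "((\<lambda>\<theta>. arccos (u \<theta>)) has_real_derivative sqrt (1 - e\<^sup>2) / (1 - e * cos \<theta>)) (at \<theta>)"
      by simp
    then show "((\<lambda>\<theta>. arccos (u \<theta>)) has_real_derivative sqrt (1 - e\<^sup>2) / (1 - e * cos \<theta>))
       (at \<theta> within {0..pi})"
      by (rule has_field_derivative_at_within)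
  qed (use u_ends in auto)
  then show ?thesis
    using u1 by (simp add: u_ends) (simp add: u_def)
qed

text \<open>The substitution with \<open>F\<close> constantly 1 and \<open>e = B / A\<close>,
  rescaled.\<close>

lemma integral_inverse_linear_cos:
  fixes A B :: real
  assumes "\<bar>B\<bar> < A"
  shows "((\<lambda>\<theta>. 1 / (A - B * cos \<theta>)) has_integral pi / sqrt (A\<^sup>2 - B\<^sup>2)) {0..pi}"
proof -
  define e where "e = B / A"
  define r where "r = sqrt (1 - e\<^sup>2)"
  have A: "0 < A" using assms by linarith
  then have B: "B = A * e" and e: "\<bar>e\<bar> < 1" using assms by (auto simp: e_def)
  have r: "0 < r" using e by (simp add: r_def abs_square_less_1)
  have "A\<^sup>2 - B\<^sup>2 = A\<^sup>2 * (1 - e\<^sup>2)"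
    by (simp add: B power_mult_distrib right_diff_distrib)
  then have root: "sqrt (A\<^sup>2 - B\<^sup>2) = A * r"
    using A by (simp add: real_sqrt_mult r_def)
  have "((\<lambda>\<theta>. 1 / (A * r) * (r / (1 - e * cos \<theta>))) has_integral 1 / (A * r) * pi) {0..pi}"
    using has_integral_mult_right[OF kepler_substitution[OF e, of "\<lambda>_. 1"], of "1 / (A * r)"]
    by (simp add: r_def)
  moreover have "1 / (A * r) * (r / (1 - e * cos \<theta>)) = 1 / (A - B * cos \<theta>)" for \<theta>
    using r A by (simp add: B right_diff_distrib)
  ultimately show ?thesis by (simp add: root)
qed

section \<open>The squared Hoyt law as a mixture of exponential laws\<close>

lemma hoyt_eps_bound:
  assumes "0 < q"
  shows "\<bar>hoyt_eps q\<bar> < 1"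
  using assms by (auto simp: hoyt_eps_def abs_less_iff divide_simps add_pos_pos)

lemma hoyt_mean_pos:
  assumes "0 < g" "0 < q"
  shows "0 < hoyt_mean g q \<theta>"
  using assms one_minus_mult_cos_pos[OF hoyt_eps_bound] by (simp add: hoyt_mean_def)

lemma hoyt_mean_measurable [measurable]: "hoyt_mean g q \<in> borel_measurable borel"
  unfolding hoyt_mean_def[abs_def] by measurable

lemma bessel_I0_minus: "bessel_I0 (- z) = bessel_I0 z"
  by (simp add: bessel_I0_def)

text \<open>The Bessel factor is written as an integral over \<open>E\<close> and moved to
  \<open>\<theta>\<close>; the exponent then becomes \<open>- x / hoyt_mean g q \<theta>\<close> and
  the Jacobian supplies the rate.\<close>

lemma squared_hoyt_density_exponential_mixture:
  assumes g: "0 < g" and q: "0 < q"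
  shows "((\<lambda>\<theta>. exponential_density (1 / hoyt_mean g q \<theta>) x) has_integral
           pi * squared_hoyt_density g q x) {0..pi}"
proof (cases "x < 0")
  case True
  then show ?thesis by (simp add: exponential_density_def squared_hoyt_density_def)
next
  case False
  define e where "e = hoyt_eps q"
  define r where "r = sqrt (1 - e\<^sup>2)"
  define a where "a = 1 / (g * (1 - e\<^sup>2))"
  have q2: "0 < 1 + q\<^sup>2" by (simp add: add_pos_nonneg)
  have e2: "1 - e\<^sup>2 = (2 * q / (1 + q\<^sup>2))\<^sup>2"
    using q2 by (simp add: e_def hoyt_eps_def divide_simps) (simp add: power2_eq_square algebra_simps)
  have r: "r = 2 * q / (1 + q\<^sup>2)"
    using q q2 by (simp add: r_def e2)
  have r0: "0 < r" using q q2 by (simp add: r)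
  have re: "1 - e\<^sup>2 = r\<^sup>2" unfolding r e2 ..
  have e: "\<bar>e\<bar> < 1" unfolding e_def using q by (rule hoyt_eps_bound)
  \<comment> \<open>Under the substitution \<open>1 + e * u\<close> becomes
    \<open>(1 - e\<^sup>2) / (1 - e * cos \<theta>)\<close>, so the scale \<open>a\<close> turns
    \<open>F\<close> into an exponential with mean
    \<open>g * (1 - e * cos \<theta>)\<close>.\<close>
  define F where "F u = exp (- x * a * (1 + e * u))" for u :: real
  have "((\<lambda>E. exp (- x * a) * exp (- x * a * e * cos E)) has_integral
           exp (- x * a) * (pi * bessel_I0 (- x * a * e))) {0..pi}"
    by (intro has_integral_mult_right bessel_I0_integral)
  then have "integral {0..pi} (\<lambda>E. F (cos E)) = exp (- x * a) * (pi * bessel_I0 (x * a * e))"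
    using bessel_I0_minus[of "x * a * e"]
    by (simp add: F_def algebra_simps integral_unique flip: exp_add)
  moreover have "continuous_on {-1..1} F"
    unfolding F_def by (intro continuous_intros)
  ultimately have "((\<lambda>\<theta>. r / (1 - e * cos \<theta>) * F ((cos \<theta> - e) / (1 - e * cos \<theta>)))
      has_integral exp (- x * a) * (pi * bessel_I0 (x * a * e))) {0..pi}"
    using kepler_substitution[OF e, of F] by (simp add: r_def)
  \<comment> \<open>This factor turns the Jacobian into the rate
    \<open>1 / hoyt_mean g q \<theta>\<close> and equals the leading constant of the Hoyt
    density.\<close>
  from has_integral_mult_right[OF this, of "1 / (g * r)"]
  have "((\<lambda>\<theta>. 1 / (g * r) * (r / (1 - e * cos \<theta>) * F ((cos \<theta> - e) / (1 - e * cos \<theta>))))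
      has_integral pi * (1 / (g * r) * exp (- x * a) * bessel_I0 (x * a * e))) {0..pi}"
    by (simp add: mult_ac)
  moreover have "1 / (g * r) * (r / (1 - e * cos \<theta>) * F ((cos \<theta> - e) / (1 - e * cos \<theta>)))
      = exponential_density (1 / hoyt_mean g q \<theta>) x" for \<theta>
  proof -
    have p: "0 < 1 - e * cos \<theta>" using e by (rule one_minus_mult_cos_pos)
    have "1 + e * ((cos \<theta> - e) / (1 - e * cos \<theta>)) = (1 - e\<^sup>2) / (1 - e * cos \<theta>)"
      using p by (simp add: divide_simps) (simp add: power2_eq_square algebra_simps)
    then have "x * a * (1 + e * ((cos \<theta> - e) / (1 - e * cos \<theta>))) = x / (g * (1 - e * cos \<theta>))"
      unfolding a_def re using r0 by simp
    then show ?thesis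
      using False r0 by (simp add: exponential_density_def F_def hoyt_mean_def flip: e_def)
  qed
  moreover have "1 / (g * r) * exp (- x * a) * bessel_I0 (x * a * e) = squared_hoyt_density g q x"
  proof -
    have eq: "(1 + q\<^sup>2)\<^sup>2 * e = 1 - q ^ 4"
      unfolding e_def hoyt_eps_def using q2
      by (simp add: power2_eq_square) (simp add: power4_eq_xxxx algebra_simps)
    have xa: "x * a = (1 + q\<^sup>2)\<^sup>2 * x / (4 * q\<^sup>2 * g)"
      unfolding a_def e2 by (simp add: power_divide power_mult_distrib mult_ac)
    then have xae: "x * a * e = (1 - q ^ 4) * x / (4 * q\<^sup>2 * g)"
      by (simp add: mult_ac flip: eq)
    have gr: "1 / (g * r) = (1 + q\<^sup>2) / (2 * q * g)" by (simp add: r)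
    show ?thesis
      unfolding mult_minus_left xae gr unfolding xa using False by (simp add: squared_hoyt_density_def)
  qed
  ultimately show ?thesis by (simp only:)
qed

text \<open>Tonelli carries the mixture from the density to any nonnegative measurable integrand;
  \<open>indicator {0..pi} \<theta> / pi\<close> is the uniform density of the mixing angle.\<close>

lemma nn_integral_squared_hoyt_density:
  fixes u :: "real \<Rightarrow> ennreal"
  assumes g: "0 < g" and q: "0 < q" and u [measurable]: "u \<in> borel_measurable borel"
  shows "(\<integral>\<^sup>+x. ennreal (squared_hoyt_density g q x) * u x \<partial>lborel) =
    (\<integral>\<^sup>+\<theta>. ennreal (indicator {0..pi} \<theta> / pi) *
       (\<integral>\<^sup>+x. ennreal (exponential_density (1 / hoyt_mean g q \<theta>) x) * u x \<partial>lborel) \<partial>lborel)"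
proof -
  note pos = hoyt_mean_pos[OF g q]
  define k where "k \<theta> x = ennreal (exponential_density (1 / hoyt_mean g q \<theta>) x)" for \<theta> x
  have [measurable]: "(\<lambda>(\<theta>, x). k \<theta> x) \<in> borel_measurable (borel \<Otimes>\<^sub>M borel)"
    unfolding k_def exponential_density_def by measurable
  have dens: "ennreal (squared_hoyt_density g q x)
      = (\<integral>\<^sup>+\<theta>. ennreal (indicator {0..pi} \<theta> / pi) * k \<theta> x \<partial>lborel)" for x
  proof -
    have "(\<integral>\<^sup>+\<theta>. ennreal (indicator {0..pi} \<theta> * (1 / pi * exponential_density (1 / hoyt_mean g q \<theta>) x)) \<partial>lborel)
      = ennreal (1 / pi * (pi * squared_hoyt_density g q x))"
      using has_integral_mult_right[OF squared_hoyt_density_exponential_mixture[OF g q, of x], of "1 / pi"] pos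
      by (intro nn_integral_has_integral_lebesgue) (auto intro!: divide_nonneg_nonneg exponential_density_nonneg)
    then show ?thesis
      using pos by (simp add: k_def mult_ac flip: ennreal_mult')
  qed
  have "(\<integral>\<^sup>+x. ennreal (squared_hoyt_density g q x) * u x \<partial>lborel)
      = (\<integral>\<^sup>+x. \<integral>\<^sup>+\<theta>. ennreal (indicator {0..pi} \<theta> / pi) * k \<theta> x * u x \<partial>lborel \<partial>lborel)"
    unfolding dens by (intro nn_integral_cong nn_integral_multc[symmetric]) measurable
  also have "\<dots> = (\<integral>\<^sup>+\<theta>. \<integral>\<^sup>+x. ennreal (indicator {0..pi} \<theta> / pi) * k \<theta> x * u x \<partial>lborel \<partial>lborel)"
    by (intro lborel_pair.Fubini') measurable
  also have "\<dots> = (\<integral>\<^sup>+\<theta>. ennreal (indicator {0..pi} \<theta> / pi) * (\<integral>\<^sup>+x. k \<theta> x * u x \<partial>lborel) \<partial>lborel)"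
    by (intro nn_integral_cong) (simp add: mult.assoc nn_integral_cmult)
  finally show ?thesis unfolding k_def .
qed

section \<open>Tail and Laplace transform of the squared Hoyt law\<close>

text \<open>\<open>A\<close> is a half line up to its endpoint \<open>c\<close>, a null set, so the
  open and closed tails are covered together.\<close>

lemma nn_integral_exponential_density_tail:
  assumes l: "0 < l" and c: "0 \<le> c" and A: "{c<..} \<subseteq> A" "A \<subseteq> {c..}"
  shows "(\<integral>\<^sup>+x. ennreal (exponential_density l x) * indicator A x \<partial>lborel) = ennreal (exp (- c * l))"
proof -
  have "(\<integral>\<^sup>+x. ennreal (exponential_density l x) * indicator A x \<partial>lborel)
      = (\<integral>\<^sup>+x. ennreal (l * exp (- x * l)) * indicator {c..} x \<partial>lborel)"
  proof (rule nn_integral_cong_AE)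
    show "AE x in lborel. ennreal (exponential_density l x) * indicator A x
        = ennreal (l * exp (- x * l)) * indicator {c..} x"
      using AE_lborel_singleton[of c]
      by eventually_elim (use c A in \<open>force simp: exponential_density_def indicator_def\<close>)
  qed
  also have "\<dots> = ennreal (0 - (- exp (- c * l)))"
  proof (rule nn_integral_FTC_atLeast)
    show "((\<lambda>x. - exp (- x * l)) has_real_derivative l * exp (- x * l)) (at x)" for x
      by (auto intro!: derivative_eq_intros)
    show "((\<lambda>x. - exp (- x * l)) \<longlongrightarrow> 0) at_top"
      using l by real_asymp
  qed (use l in auto)
  finally show ?thesis by simp
qed

text \<open>Exponential tilting: the integrand is \<open>l / (l + s)\<close> times the exponential
  density of rate \<open>l + s\<close>, whose mass is 1.\<close>

lemma nn_integral_exponential_density_laplace: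
  assumes l: "0 < l" and s: "0 \<le> s"
  shows "(\<integral>\<^sup>+x. ennreal (exponential_density l x) * ennreal (exp (- s * x)) \<partial>lborel) = ennreal (l / (l + s))"
proof -
  interpret prob_space "density lborel (exponential_density (l + s))"
    using l s by (intro prob_space_exponential_density) simp
  have "(\<integral>\<^sup>+x. ennreal (exponential_density l x) * ennreal (exp (- s * x)) \<partial>lborel)
      = (\<integral>\<^sup>+x. ennreal (l / (l + s)) * ennreal (exponential_density (l + s) x) \<partial>lborel)"
    using l s by (intro nn_integral_cong)
      (auto simp: exponential_density_def distrib_left mult.commute simp flip: ennreal_mult' exp_add)
  also have "\<dots> = ennreal (l / (l + s)) * (\<integral>\<^sup>+x. ennreal (exponential_density (l + s) x) \<partial>lborel)"
    by (rule nn_integral_cmult) measurable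
  also have "(\<integral>\<^sup>+x. ennreal (exponential_density (l + s) x) \<partial>lborel) = 1"
    using emeasure_space_1 by (simp add: emeasure_density)
  finally show ?thesis by simp
qed

lemma squared_hoyt_tail:
  assumes "0 < g" "0 < q" "0 \<le> c" "A \<in> sets borel" "{c<..} \<subseteq> A" "A \<subseteq> {c..}"
  shows "(\<integral>\<^sup>+x. ennreal (squared_hoyt_density g q x) * indicator A x \<partial>lborel)
    = (\<integral>\<^sup>+\<theta>. ennreal (indicator {0..pi} \<theta> / pi) * ennreal (exp (- (c / hoyt_mean g q \<theta>))) \<partial>lborel)"
  using assms hoyt_mean_pos[of g q]
  by (simp add: nn_integral_squared_hoyt_density nn_integral_exponential_density_tail)

text \<open>Averaging the exponential transform \<open>1 / (1 + s * h)\<close> over the random mean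
  \<open>h\<close> gives the reciprocal of a function affine in \<open>cos \<theta>\<close>,
  integrated in closed form above.\<close>

lemma squared_hoyt_laplace:
  assumes g: "0 < g" and q: "0 < q" and s: "0 \<le> s"
  shows "(\<integral>\<^sup>+x. ennreal (squared_hoyt_density g q x) * ennreal (exp (- s * x)) \<partial>lborel)
    = ennreal (1 / sqrt ((1 + s * g)\<^sup>2 - (s * g * hoyt_eps q)\<^sup>2))"
proof -
  note pos = hoyt_mean_pos[OF g q]
  have B: "\<bar>s * g * hoyt_eps q\<bar> < 1 + s * g"
  proof -
    have "\<bar>s * g * hoyt_eps q\<bar> \<le> s * g * 1"
      unfolding abs_mult using s g hoyt_eps_bound[OF q] by (intro mult_mono) auto
    then show ?thesis by simp
  qed
  have mean: "1 / hoyt_mean g q \<theta> / (1 / hoyt_mean g q \<theta> + s) = 1 / (1 + s * g - s * g * hoyt_eps q * cos \<theta>)" for \<theta>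
  proof -
    have "1 / h / (1 / h + s) = 1 / (1 + s * h)" if "0 < h" for h
      using that s by (simp add: divide_simps add_pos_nonneg)
    from this[OF pos[of \<theta>]] show ?thesis by (simp add: hoyt_mean_def right_diff_distrib mult_ac add_diff_eq)
  qed
  have "(\<integral>\<^sup>+x. ennreal (squared_hoyt_density g q x) * ennreal (exp (- s * x)) \<partial>lborel)
      = (\<integral>\<^sup>+\<theta>. ennreal (indicator {0..pi} \<theta> / pi) * ennreal (1 / hoyt_mean g q \<theta> / (1 / hoyt_mean g q \<theta> + s)) \<partial>lborel)"
    using nn_integral_exponential_density_laplace[OF _ s] pos
    by (subst nn_integral_squared_hoyt_density[OF g q]) auto
  also have "\<dots> = (\<integral>\<^sup>+\<theta>. ennreal (indicator {0..pi} \<theta> * (1 / pi * (1 / (1 + s * g - s * g * hoyt_eps q * cos \<theta>)))) \<partial>lborel)"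
    unfolding mean by (simp flip: ennreal_mult')
  also have "\<dots> = ennreal (1 / pi * (pi / sqrt ((1 + s * g)\<^sup>2 - (s * g * hoyt_eps q)\<^sup>2)))"
  proof (intro nn_integral_has_integral_lebesgue has_integral_mult_right integral_inverse_linear_cos B)
    show "0 \<le> 1 / pi * (1 / (1 + s * g - s * g * hoyt_eps q * cos \<theta>))" for \<theta>
      unfolding mean[symmetric] using pos[of \<theta>] s by simp
  qed
  finally show ?thesis by simp
qed

section \<open>Probability that one variable exceeds an affine function of the other\<close>

text \<open>Brings the Laplace transform at \<open>t / h\<close> into the shape of the final
  formulas by pulling \<open>(h + t * g) / h\<close> out of the root.\<close>

lemma laplace_factor_eq:
  fixes e g h t :: real
  assumes h: "0 < h" and t: "0 < t" and g: "0 < g"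
  shows "1 / sqrt ((1 + t / h * g)\<^sup>2 - (t / h * g * e)\<^sup>2)
    = h / (h + t * g) * (1 / sqrt (1 - (e * t * g / (h + t * g))\<^sup>2))"
proof -
  define k where "k = h + t * g"
  have k: "0 < k" using assms by (simp add: k_def add_pos_pos)
  have "1 + t / h * g = k / h" using h by (simp add: k_def field_simps)
  moreover have "t / h * g * e = k / h * (e * t * g / k)" using k by simp
  ultimately have "(1 + t / h * g)\<^sup>2 - (t / h * g * e)\<^sup>2 = (k / h)\<^sup>2 * (1 - (e * t * g / k)\<^sup>2)"
    by (simp only: power_mult_distrib right_diff_distrib mult_1_right)
  then have "sqrt ((1 + t / h * g)\<^sup>2 - (t / h * g * e)\<^sup>2) = k / h * sqrt (1 - (e * t * g / k)\<^sup>2)"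
    using h k by (simp add: real_sqrt_mult)
  then show ?thesis by (simp add: k_def)
qed

text \<open>The boundary of the half plane is null, so \<open>A\<close> may contain any part of it; this treats
  the strict and the non-strict comparison at once.\<close>

lemma (in prob_space) squared_hoyt_affine_comparison:
  fixes X Y :: "'a \<Rightarrow> real"
  assumes gb: "0 < gb" and ge: "0 < ge" and qb: "0 < qb" and qe: "0 < qe"
    and X: "squared_hoyt_distributed M X gb qb" and Y: "squared_hoyt_distributed M Y ge qe"
    and indep: "indep_var borel X borel Y"
    and t: "0 < t" and c: "0 \<le> c"
    and A [measurable]: "A \<in> sets (borel \<Otimes>\<^sub>M borel)"
    and sub: "\<And>x y. 0 \<le> y \<Longrightarrow> t * y + c < x \<Longrightarrow> (x, y) \<in> A"
    and sup: "\<And>x y. 0 \<le> y \<Longrightarrow> (x, y) \<in> A \<Longrightarrow> t * y + c \<le> x"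
  shows "\<P>(\<omega> in M. (X \<omega>, Y \<omega>) \<in> A) = 1 / pi * integral {0..pi} (\<lambda>\<theta>.
           exp (- (c / hoyt_mean gb qb \<theta>))
           * (hoyt_mean gb qb \<theta> / (hoyt_mean gb qb \<theta> + t * ge))
           * (1 / sqrt (1 - (hoyt_eps qe * t * ge / (hoyt_mean gb qb \<theta> + t * ge))\<^sup>2)))"
    (is "_ = 1 / pi * integral _ ?I")
proof -
  define h where "h = hoyt_mean gb qb"
  define fb where "fb x = ennreal (squared_hoyt_density gb qb x)" for x
  define fe where "fe y = ennreal (squared_hoyt_density ge qe y)" for y
  have h: "0 < h \<theta>" for \<theta> unfolding h_def using gb qb by (rule hoyt_mean_pos)
  have k: "0 < hoyt_mean gb qb \<theta> + t * ge" for \<theta>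
    using h[of \<theta>] t ge by (simp add: h_def add_pos_pos)
  have pos: "0 < 1 - (hoyt_eps qe * t * ge / (hoyt_mean gb qb \<theta> + t * ge))\<^sup>2" for \<theta>
  proof -
    have "\<bar>hoyt_eps qe * t * ge\<bar> \<le> 1 * (t * ge)"
      unfolding abs_mult mult.assoc using t ge hoyt_eps_bound[OF qe] by (intro mult_mono) auto
    also have "\<dots> < hoyt_mean gb qb \<theta> + t * ge" using h[of \<theta>] by (simp add: h_def)
    finally have "\<bar>hoyt_eps qe * t * ge / (hoyt_mean gb qb \<theta> + t * ge)\<bar> < 1"
      using k[of \<theta>] by simp
    then show ?thesis by (simp only: abs_square_less_1 diff_gt_0_iff_gt)
  qed
  have nonneg: "0 \<le> ?I \<theta>" for \<theta>
    using h[of \<theta>] k[of \<theta>] pos[of \<theta>] by (intro mult_nonneg_nonneg divide_nonneg_nonneg) (auto simp: h_def)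
  have m: "continuous_on {0..pi} (hoyt_mean gb qb)"
    unfolding hoyt_mean_def[abs_def] by (intro continuous_intros)
  have nz: "hoyt_mean gb qb \<theta> \<noteq> 0" "hoyt_mean gb qb \<theta> + t * ge \<noteq> 0"
      "sqrt (1 - (hoyt_eps qe * t * ge / (hoyt_mean gb qb \<theta> + t * ge))\<^sup>2) \<noteq> 0" for \<theta>
    using h[of \<theta>] k[of \<theta>] pos[of \<theta>] by (auto simp: h_def)
  \<comment> \<open>Continuity gives integrability, so the Lebesgue integral reached at the end can
    be identified with the gauge integral in the statement.\<close>
  have "continuous_on {0..pi} ?I"
    by (intro continuous_intros m ballI nz)
  then have int: "?I integrable_on {0..pi}" by (rule integrable_continuous_real)
  have [measurable]: "h \<in> borel_measurable borel" by (simp add: h_def)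
  have X': "distributed M lborel X fb" and Y': "distributed M lborel Y fe"
    using X Y by (simp_all add: squared_hoyt_distributed_def fb_def[abs_def] fe_def[abs_def])
  then have [measurable]: "fb \<in> borel_measurable borel" "fe \<in> borel_measurable borel"
    by (auto dest: distributed_borel_measurable)
  \<comment> \<open>\<open>borel\<close> and \<open>lborel\<close> have the same measurable sets, so
    independence transfers to the reference measure of the densities.\<close>
  have "indep_var lborel X lborel Y" using indep by (simp add: indep_var_eq)
  then have "distributed M (lborel \<Otimes>\<^sub>M lborel) (\<lambda>\<omega>. (X \<omega>, Y \<omega>)) (\<lambda>(x, y). fb x * fe y)"
    using X' Y' by (intro distributed_joint_indep lborel.sigma_finite_measure_axioms)
  then have "emeasure M ((\<lambda>\<omega>. (X \<omega>, Y \<omega>)) -` A \<inter> space M)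
      = (\<integral>\<^sup>+z. (case z of (x, y) \<Rightarrow> fb x * fe y) * indicator A z \<partial>(lborel \<Otimes>\<^sub>M lborel))"
    by (rule distributed_emeasure) (use A in simp)
  \<comment> \<open>With \<open>x\<close> integrated first, each fixed \<open>y\<close> calls for a
    tail of \<open>X\<close> at \<open>t * y + c\<close>.\<close>
  also have "\<dots> = (\<integral>\<^sup>+y. \<integral>\<^sup>+x. fb x * fe y * indicator A (x, y) \<partial>lborel \<partial>lborel)"
    by (subst lborel_pair.nn_integral_snd[symmetric]) (auto simp: split_beta)
  also have "\<dots> = (\<integral>\<^sup>+y. \<integral>\<^sup>+\<theta>. ennreal (indicator {0..pi} \<theta> / pi) * ennreal (exp (- (c / h \<theta>)))
      * (fe y * ennreal (exp (- (t / h \<theta>) * y))) \<partial>lborel \<partial>lborel)"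
  proof (rule nn_integral_cong)
    fix y :: real
    show "(\<integral>\<^sup>+x. fb x * fe y * indicator A (x, y) \<partial>lborel)
      = (\<integral>\<^sup>+\<theta>. ennreal (indicator {0..pi} \<theta> / pi) * ennreal (exp (- (c / h \<theta>)))
          * (fe y * ennreal (exp (- (t / h \<theta>) * y))) \<partial>lborel)"
    \<comment> \<open>For negative \<open>y\<close> the density of \<open>Y\<close> is 0; otherwise
      the slice of \<open>A\<close> is a half line up to its endpoint.\<close>
    proof (cases "y < 0")
      case True
      then show ?thesis by (simp add: fe_def squared_hoyt_density_def)
    next
      case False
      then have y: "0 \<le> y" by simp
      define S where "S = {x. (x, y) \<in> A}"
      have S: "S \<in> sets borel" unfolding S_def by measurable
      have "(\<integral>\<^sup>+x. fb x * fe y * indicator A (x, y) \<partial>lborel) = (\<integral>\<^sup>+x. fe y * (fb x * indicator S x) \<partial>lborel)"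
        by (intro nn_integral_cong) (auto simp: S_def indicator_def mult.commute)
      also have "\<dots> = fe y * (\<integral>\<^sup>+x. fb x * indicator S x \<partial>lborel)"
        by (intro nn_integral_cmult) (use S in measurable)
      also have "(\<integral>\<^sup>+x. fb x * indicator S x \<partial>lborel)
          = (\<integral>\<^sup>+\<theta>. ennreal (indicator {0..pi} \<theta> / pi) * ennreal (exp (- ((t * y + c) / h \<theta>))) \<partial>lborel)"
        unfolding fb_def h_def
        by (rule squared_hoyt_tail[OF gb qb _ S]) (use t c y sub sup in \<open>auto simp: S_def\<close>)
      also have "fe y * \<dots> = (\<integral>\<^sup>+\<theta>. fe y * (ennreal (indicator {0..pi} \<theta> / pi)
          * ennreal (exp (- ((t * y + c) / h \<theta>)))) \<partial>lborel)"
        by (rule nn_integral_cmult[symmetric]) measurable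
      also have "\<dots> = (\<integral>\<^sup>+\<theta>. ennreal (indicator {0..pi} \<theta> / pi) * ennreal (exp (- (c / h \<theta>)))
          * (fe y * ennreal (exp (- (t / h \<theta>) * y))) \<partial>lborel)"
      proof (intro nn_integral_cong)
        fix \<theta>
        have "exp (- ((t * y + c) / h \<theta>)) = exp (- (c / h \<theta>)) * exp (- (t / h \<theta>) * y)"
          by (simp add: add_divide_distrib flip: exp_add)
        then show "fe y * (ennreal (indicator {0..pi} \<theta> / pi) * ennreal (exp (- ((t * y + c) / h \<theta>))))
          = ennreal (indicator {0..pi} \<theta> / pi) * ennreal (exp (- (c / h \<theta>)))
            * (fe y * ennreal (exp (- (t / h \<theta>) * y)))"
          by (simp only: ennreal_mult' exp_ge_zero mult_ac)
      qed
      finally show ?thesis .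
    qed
  qed
  \<comment> \<open>Swapping again makes \<open>y\<close> the inner variable, whose integral is the
    Laplace transform of \<open>Y\<close> at \<open>t / h \<theta>\<close>.\<close>
  also have "\<dots> = (\<integral>\<^sup>+\<theta>. \<integral>\<^sup>+y. ennreal (indicator {0..pi} \<theta> / pi) * ennreal (exp (- (c / h \<theta>)))
      * (fe y * ennreal (exp (- (t / h \<theta>) * y))) \<partial>lborel \<partial>lborel)"
    by (intro lborel_pair.Fubini') measurable
  also have "\<dots> = (\<integral>\<^sup>+\<theta>. ennreal (indicator {0..pi} \<theta> / pi) * ennreal (exp (- (c / h \<theta>)))
      * ennreal (1 / sqrt ((1 + t / h \<theta> * ge)\<^sup>2 - (t / h \<theta> * ge * hoyt_eps qe)\<^sup>2)) \<partial>lborel)"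
  proof (rule nn_integral_cong)
    fix \<theta>
    have "0 \<le> t / h \<theta>" using t h[of \<theta>] by simp
    then show "(\<integral>\<^sup>+y. ennreal (indicator {0..pi} \<theta> / pi) * ennreal (exp (- (c / h \<theta>)))
        * (fe y * ennreal (exp (- (t / h \<theta>) * y))) \<partial>lborel)
      = ennreal (indicator {0..pi} \<theta> / pi) * ennreal (exp (- (c / h \<theta>)))
        * ennreal (1 / sqrt ((1 + t / h \<theta> * ge)\<^sup>2 - (t / h \<theta> * ge * hoyt_eps qe)\<^sup>2))"
      using squared_hoyt_laplace[OF ge qe, of "t / h \<theta>"]
      by (subst nn_integral_cmult) (measurable, simp add: fe_def)
  qed
  also have "\<dots> = (\<integral>\<^sup>+\<theta>. ennreal (indicator {0..pi} \<theta> * (1 / pi * ?I \<theta>)) \<partial>lborel)"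
  proof (rule nn_integral_cong)
    fix \<theta>
    show "ennreal (indicator {0..pi} \<theta> / pi) * ennreal (exp (- (c / h \<theta>)))
        * ennreal (1 / sqrt ((1 + t / h \<theta> * ge)\<^sup>2 - (t / h \<theta> * ge * hoyt_eps qe)\<^sup>2))
      = ennreal (indicator {0..pi} \<theta> * (1 / pi * ?I \<theta>))"
      unfolding laplace_factor_eq[OF h t ge]
      by (simp only: h_def) (simp add: mult.assoc flip: ennreal_mult')
  qed
  also have "\<dots> = ennreal (1 / pi * integral {0..pi} ?I)"
  proof (rule nn_integral_has_integral_lebesgue)
    show "0 \<le> 1 / pi * ?I \<theta>" for \<theta>
      by (rule mult_nonneg_nonneg[OF _ nonneg]) simp
    show "((\<lambda>\<theta>. 1 / pi * ?I \<theta>) has_integral 1 / pi * integral {0..pi} ?I) {0..pi}"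
      by (rule has_integral_mult_right[OF integrable_integral[OF int]])
  qed
  finally have em: "emeasure M ((\<lambda>\<omega>. (X \<omega>, Y \<omega>)) -` A \<inter> space M) = ennreal (1 / pi * integral {0..pi} ?I)" .
  \<comment> \<open>Nonnegativity lets the extended value be read back as a real
    probability.\<close>
  have "0 \<le> 1 / pi * integral {0..pi} ?I"
    by (rule mult_nonneg_nonneg[OF _ Henstock_Kurzweil_Integration.integral_nonneg[OF int nonneg]]) simp
  moreover have "{\<omega> \<in> space M. (X \<omega>, Y \<omega>) \<in> A} = (\<lambda>\<omega>. (X \<omega>, Y \<omega>)) -` A \<inter> space M" by auto
  ultimately show ?thesis using em by (simp add: measure_def)
qed

section \<open>Secrecy outage and strictly positive secrecy capacity\<close>

theorem mainTheorem7:
  fixes M :: "'a measure" and \<gamma>b \<gamma>e :: "'a \<Rightarrow> real" and gb ge qb qe :: real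
  assumes "prob_space M"
    and "gb > 0" and "ge > 0"
    and "0 < qb" and "qb \<le> 1" and "0 < qe" and "qe \<le> 1"
    and "squared_hoyt_distributed M \<gamma>b gb qb"
    and "squared_hoyt_distributed M \<gamma>e ge qe"
    and "prob_space.indep_var M borel \<gamma>b borel \<gamma>e"
  shows "(\<forall>R > 0. \<P>(\<omega> in M. secrecy_capacity (\<gamma>b \<omega>) (\<gamma>e \<omega>) < R) =
            1 - 1 / pi * integral {0..pi} (\<lambda>\<theta>.
              exp (- ((2 powr R - 1) / hoyt_mean gb qb \<theta>))
              * (hoyt_mean gb qb \<theta> / (hoyt_mean gb qb \<theta> + 2 powr R * ge))
              * (1 / sqrt (1 - (hoyt_eps qe * 2 powr R * ge
                                / (hoyt_mean gb qb \<theta> + 2 powr R * ge))\<^sup>2)))) \<and>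
         \<P>(\<omega> in M. secrecy_capacity (\<gamma>b \<omega>) (\<gamma>e \<omega>) > 0) =
            1 / pi * integral {0..pi} (\<lambda>\<theta>.
              hoyt_mean gb qb \<theta> / (hoyt_mean gb qb \<theta> + ge)
              * (1 / sqrt (1 - (hoyt_eps qe * ge / (hoyt_mean gb qb \<theta> + ge))\<^sup>2)))"
  (is "(\<forall>R > 0. ?outage R) \<and> ?positive")
proof -
  interpret prob_space M by fact
  note cmp = squared_hoyt_affine_comparison[OF assms(2,3,4,6,8,9,10)]
  have [measurable]: "random_variable borel \<gamma>b" "random_variable borel \<gamma>e"
    using assms(10) by (auto simp: indep_var_distribution_eq)
  \<comment> \<open>The density vanishes on the negative axis; almost surely, then, both logarithms
    have positive arguments and can be compared monotonically.\<close>
  have nonneg: "AE \<omega> in M. 0 \<le> X \<omega>" if "squared_hoyt_distributed M X g q" for X g q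
  proof -
    have "AE x in lborel. 0 < ennreal (squared_hoyt_density g q x) \<longrightarrow> 0 \<le> x"
      by (intro AE_I2 impI, rule ccontr) (simp add: squared_hoyt_density_def)
    moreover have "distributed M lborel X (\<lambda>x. ennreal (squared_hoyt_density g q x))"
      using that by (simp add: squared_hoyt_distributed_def)
    ultimately show ?thesis by (subst distributed_AE2) auto
  qed
  note nn = nonneg[OF assms(8)] nonneg[OF assms(9)]
  \<comment> \<open>Exponentiating yields the slope \<open>2 powr R\<close> and the offset
    \<open>2 powr R - 1\<close> of the affine comparison.\<close>
  have lt: "log 2 (1 + y) + R \<le> log 2 (1 + x) \<longleftrightarrow> 2 powr R * y + (2 powr R - 1) \<le> x"
    if "0 \<le> x" "0 \<le> y" for x y R :: real
  proof -
    have "log 2 (1 + y) + R = log 2 (2 powr R * (1 + y))"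
      using that by (simp add: log_mult)
    moreover have "log 2 (2 powr R * (1 + y)) \<le> log 2 (1 + x) \<longleftrightarrow> 2 powr R * (1 + y) \<le> 1 + x"
      by (rule log_le_cancel_iff) (use that in auto)
    ultimately have "log 2 (1 + y) + R \<le> log 2 (1 + x) \<longleftrightarrow> 2 powr R * (1 + y) \<le> 1 + x"
      by (simp only:)
    then show ?thesis by (simp add: algebra_simps)
  qed
  have cap_lt: "{\<omega> \<in> space M. secrecy_capacity (\<gamma>b \<omega>) (\<gamma>e \<omega>) < R} \<in> events" for R
    unfolding secrecy_capacity_def by measurable
  have half_plane: "{z :: real \<times> real. t * snd z + c \<le> fst z} \<in> sets (borel \<Otimes>\<^sub>M borel)"
    "{\<omega> \<in> space M. t * \<gamma>e \<omega> + c \<le> \<gamma>b \<omega>} \<in> events" for t c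
  proof -
    have "{z \<in> space (borel \<Otimes>\<^sub>M borel). t * snd z + c \<le> fst z} \<in> sets (borel \<Otimes>\<^sub>M borel)"
      by measurable
    then show "{z. t * snd z + c \<le> fst z} \<in> sets (borel \<Otimes>\<^sub>M borel)"
      by (simp add: space_pair_measure)
    show "{\<omega> \<in> space M. t * \<gamma>e \<omega> + c \<le> \<gamma>b \<omega>} \<in> events"
      by measurable
  qed
  \<comment> \<open>The complement of outage is a closed half plane; as \<open>R\<close> is
    positive, truncating the capacity at 0 does not affect the comparison with
    \<open>R\<close>.\<close>
  have outage: "\<P>(\<omega> in M. secrecy_capacity (\<gamma>b \<omega>) (\<gamma>e \<omega>) < R) =
      1 - \<P>(\<omega> in M. (\<gamma>b \<omega>, \<gamma>e \<omega>) \<in> {z. 2 powr R * snd z + (2 powr R - 1) \<le> fst z})" if "R > 0" for R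
  proof -
    have "\<P>(\<omega> in M. (\<gamma>b \<omega>, \<gamma>e \<omega>) \<in> {z. 2 powr R * snd z + (2 powr R - 1) \<le> fst z})
        = \<P>(\<omega> in M. \<not> secrecy_capacity (\<gamma>b \<omega>) (\<gamma>e \<omega>) < R)"
    proof (rule prob_eq_AE)
      show "AE \<omega> in M. (\<gamma>b \<omega>, \<gamma>e \<omega>) \<in> {z. 2 powr R * snd z + (2 powr R - 1) \<le> fst z}
          \<longleftrightarrow> \<not> secrecy_capacity (\<gamma>b \<omega>) (\<gamma>e \<omega>) < R"
        using nn
      proof eventually_elim
        case (elim \<omega>)
        have "\<not> secrecy_capacity (\<gamma>b \<omega>) (\<gamma>e \<omega>) < R
            \<longleftrightarrow> log 2 (1 + \<gamma>e \<omega>) + R \<le> log 2 (1 + \<gamma>b \<omega>)"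
          using \<open>R > 0\<close> unfolding secrecy_capacity_def max_less_iff_conj by linarith
        then show ?case by (simp only: lt[OF elim] mem_Collect_eq fst_conv snd_conv)
      qed
      show "{\<omega> \<in> space M. \<not> secrecy_capacity (\<gamma>b \<omega>) (\<gamma>e \<omega>) < R} \<in> events"
        by (rule sets.sets_Collect_neg[OF cap_lt])
      show "{\<omega> \<in> space M. (\<gamma>b \<omega>, \<gamma>e \<omega>) \<in> {z. 2 powr R * snd z + (2 powr R - 1) \<le> fst z}} \<in> events"
        unfolding mem_Collect_eq fst_conv snd_conv by (rule half_plane(2))
    qed
    then show ?thesis
      by (simp only: prob_neg[OF cap_lt] diff_diff_eq2 add_diff_cancel_left')
  qed
  have affine: "\<P>(\<omega> in M. (\<gamma>b \<omega>, \<gamma>e \<omega>) \<in> {z. 2 powr R * snd z + (2 powr R - 1) \<le> fst z})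
      = 1 / pi * integral {0..pi} (\<lambda>\<theta>. exp (- ((2 powr R - 1) / hoyt_mean gb qb \<theta>))
              * (hoyt_mean gb qb \<theta> / (hoyt_mean gb qb \<theta> + 2 powr R * ge))
              * (1 / sqrt (1 - (hoyt_eps qe * 2 powr R * ge
                                / (hoyt_mean gb qb \<theta> + 2 powr R * ge))\<^sup>2)))" if "R > 0" for R
    by (rule cmp) (use that half_plane(1)[of "2 powr R" "2 powr R - 1"] in \<open>auto simp: ge_one_powr_ge_zero\<close>)
  have positive: "\<P>(\<omega> in M. secrecy_capacity (\<gamma>b \<omega>) (\<gamma>e \<omega>) > 0)
      = \<P>(\<omega> in M. (\<gamma>b \<omega>, \<gamma>e \<omega>) \<in> {z. snd z < fst z})"
  proof (rule prob_eq_AE)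
    show "AE \<omega> in M. secrecy_capacity (\<gamma>b \<omega>) (\<gamma>e \<omega>) > 0 \<longleftrightarrow> (\<gamma>b \<omega>, \<gamma>e \<omega>) \<in> {z. snd z < fst z}"
      using nn by eventually_elim (auto simp: secrecy_capacity_def less_max_iff_disj)
    show "{\<omega> \<in> space M. 0 < secrecy_capacity (\<gamma>b \<omega>) (\<gamma>e \<omega>)} \<in> events"
      unfolding secrecy_capacity_def by measurable
    show "{\<omega> \<in> space M. (\<gamma>b \<omega>, \<gamma>e \<omega>) \<in> {z. snd z < fst z}} \<in> events"
      unfolding mem_Collect_eq fst_conv snd_conv by measurable
  qed
  \<comment> \<open>The open half plane with slope 1 and offset 0; the trivial factors keep the
    shape of the general formula and are simplified at the end.\<close>
  have linear: "\<P>(\<omega> in M. (\<gamma>b \<omega>, \<gamma>e \<omega>) \<in> {z. snd z < fst z})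
      = 1 / pi * integral {0..pi} (\<lambda>\<theta>. exp (- (0 / hoyt_mean gb qb \<theta>))
              * (hoyt_mean gb qb \<theta> / (hoyt_mean gb qb \<theta> + 1 * ge))
              * (1 / sqrt (1 - (hoyt_eps qe * 1 * ge / (hoyt_mean gb qb \<theta> + 1 * ge))\<^sup>2)))"
  proof (rule cmp)
    have "{z \<in> space (borel \<Otimes>\<^sub>M borel). snd z < fst z} \<in> sets (borel \<Otimes>\<^sub>M (borel :: real measure))"
      by measurable
    then show "{z :: real \<times> real. snd z < fst z} \<in> sets (borel \<Otimes>\<^sub>M borel)"
      by (simp add: space_pair_measure)
  qed auto
  show ?thesis
  proof (intro conjI allI impI)
    fix R :: real
    assume "R > 0"
    note outage[OF this, unfolded affine[OF this]]
    then show "?outage R" .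
  next
    show ?positive
      unfolding positive linear by (simp only: minus_zero div_0 exp_zero mult_1 mult_1_right)
  qed
qed

end
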